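(* There exist absolute constants $C>0$ and $c>0$ such that for every positive integer $k$ and every real $\rho$ with $0<\rho\le 1$, $$\mathcal{M}(C\rho,\mathcal{W}_\rho,\delta_2)\ \ge\ 2^{c k^2}.$$
   Context: A graphon is a symmetric measurable function $W:[0,1]^2\to[0,1]$; $\mathcal{W}_\rho$ is the set of graphons taking values in $[0,\rho]$. For graphons $W,W'$, $\delta_2(W,W')=\inf_\phi\|W_\phi-W'\|_2$, where $\phi$ ranges over all measurable measure-preserving maps $[0,1]\to[0,1]$ (Lebesgue measure), $W_\phi(x,y)=W(\phi(x),\phi(y))$, and $\|\cdot\|_2$ is the $L_2$ norm on $[0,1]^2$. ($\delta_2$ is a pseudometric on graphons; graphons at distance $0$ are identified.) For a metric space $(\Omega,d)$, $T\subset\Omega$ and $\epsilon>0$, the $\epsilon$-packing number $\mathcal{M}(\epsilon,T,d)$ is the largest number of pairwise disjoint balls of radius $\epsilon$ that can fit in $T$ (the supremum, possibly infinite); for $T=\mathcal{W}_\rho$ the balls are those of the metric space $(\mathcal{W}_\rho,\delta_2)$. *)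

theory Defs
  imports "HOL-Analysis.Analysis"
begin

abbreviation unit_itv :: "real set" where
  "unit_itv \<equiv> {0..1}"

text \<open>
  A graphon is a total function of two real arguments, constrained only on the unit square.
  Measurability is Lebesgue measurability throughout.  Values off the unit square play no role
  in any of the notions below, so graphons agreeing on the square are at distance 0.
\<close>

definition graphon :: "(real \<Rightarrow> real \<Rightarrow> real) \<Rightarrow> bool" where
  "graphon W \<longleftrightarrow>
     (\<lambda>(x, y). W x y) \<in> borel_measurable (lebesgue_on (unit_itv \<times> unit_itv)) \<and>
     (\<forall>x\<in>unit_itv. \<forall>y\<in>unit_itv. W x y = W y x \<and> 0 \<le> W x y \<and> W x y \<le> 1)"

definition graphons_upto :: "real \<Rightarrow> (real \<Rightarrow> real \<Rightarrow> real) set" where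
  "graphons_upto \<rho> = {W. graphon W \<and> (\<forall>x\<in>unit_itv. \<forall>y\<in>unit_itv. W x y \<in> {0..\<rho>})}"

definition measure_preserving_maps :: "(real \<Rightarrow> real) set" where
  "measure_preserving_maps =
     {\<phi>. \<phi> \<in> lebesgue_on unit_itv \<rightarrow>\<^sub>M lebesgue_on unit_itv \<and>
         distr (lebesgue_on unit_itv) (lebesgue_on unit_itv) \<phi> = lebesgue_on unit_itv}"

definition L2_norm :: "(real \<Rightarrow> real \<Rightarrow> real) \<Rightarrow> real" where
  "L2_norm f = sqrt (\<integral>(x, y). (f x y)\<^sup>2 \<partial>lebesgue_on (unit_itv \<times> unit_itv))"

definition pullback :: "(real \<Rightarrow> real \<Rightarrow> real) \<Rightarrow> (real \<Rightarrow> real) \<Rightarrow> real \<Rightarrow> real \<Rightarrow> real" where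
  "pullback W \<phi> = (\<lambda>x y. W (\<phi> x) (\<phi> y))"

definition delta2 :: "(real \<Rightarrow> real \<Rightarrow> real) \<Rightarrow> (real \<Rightarrow> real \<Rightarrow> real) \<Rightarrow> real" where
  "delta2 W W' = (INF \<phi>\<in>measure_preserving_maps. L2_norm (\<lambda>x y. pullback W \<phi> x y - W' x y))"

definition open_ball :: "'a set \<Rightarrow> ('a \<Rightarrow> 'a \<Rightarrow> real) \<Rightarrow> 'a \<Rightarrow> real \<Rightarrow> 'a set" where
  "open_ball \<Omega> d x \<epsilon> = {y \<in> \<Omega>. d x y < \<epsilon>}"

text \<open>
  The packing number counts families of balls of \<open>(\<Omega>, d)\<close>, each ball being taken as a set of points.
  A ball of a pseudometric is a union of classes of points at distance 0, so for a pseudometric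
  the count agrees with the one in the quotient metric space, and no quotient is formed.
  Since \<^const>\<open>delta2\<close> is only a pseudometric on total functions, \<^locale>\<open>Metric_space\<close> and its
  balls do not apply.
\<close>

definition packing_number ::
    "'a set \<Rightarrow> ('a \<Rightarrow> 'a \<Rightarrow> real) \<Rightarrow> real \<Rightarrow> 'a set \<Rightarrow> enat" where
  "packing_number \<Omega> d \<epsilon> T =
     (SUP \<B>\<in>{\<B>. finite \<B> \<and> \<B> \<subseteq> {open_ball \<Omega> d x \<epsilon> |x. x \<in> \<Omega>} \<and>
                (\<forall>B\<in>\<B>. B \<subseteq> T) \<and> pairwise disjnt \<B>}. enat (card \<B>))"

end

theory Submission
  imports Defs
begin

text \<open>
  The centres of the balls are step graphons with values 0 and \<open>\<rho>\<close>, one for each graph in a suitable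
  family of graphs on \<open>n = 64 * k\<close> vertices; the constants are \<open>C = 1/16\<close> and \<open>c = 1\<close>.

  If two balls of radius \<open>\<epsilon>\<close> meet, then some pullbacks of their centres are at \<open>L\<^sub>2\<close> distance less than
  \<open>2 * \<epsilon>\<close> (\<open>packing_number_ge_card\<close>). For step graphons of graphs \<open>G\<close> and \<open>G'\<close>, such a pair of
  pullbacks amounts to a coupling of the vertices of \<open>G\<close> with those of \<open>G'\<close>. There is a continuum of
  couplings, but the number of disagreeing edges is multilinear in the conditional distributions of the
  vertex of \<open>G\<close> given the vertex of \<open>G'\<close>. Hence the coupling can be rounded to a vertex map \<open>f\<close> without
  increasing the number of disagreements (\<open>exists_rounding\<close>, \<open>exists_vertex_map_close\<close>). So if \<open>G'\<close> is
  near \<open>G\<close>, then \<open>G'\<close> differs in at most \<open>n\<^sup>2 / 64\<close> edges from the preimage of \<open>G\<close> under some \<open>f\<close>.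

  There are only \<open>(n + 1) ^ n\<close> vertex maps, and a Hamming ball of that radius contains an exponentially small
  proportion of the \<open>2 ^ (n choose 2)\<close> graphs. A maximal family of graphs no two of which are near
  therefore has at least \<open>2 ^ k\<^sup>2\<close> members (\<open>exists_separated_subfamily\<close>, \<open>counting_estimate\<close>).
\<close>

section \<open>Rounding independent random coordinates\<close>

text \<open>
  If every coordinate \<open>j\<close> is drawn independently with distribution \<open>p j\<close>, then the right-hand side
  is the expected value of the left-hand side, so some outcome does at least as well. The proof fixes
  the coordinates one at a time, beginning with the last: as a function of the distribution of a
  single coordinate the expectation is affine, hence at least its value at some point mass. The linear
  term \<open>l\<close> is there to absorb the interactions with coordinates that are already fixed.
\<close>

lemma exists_rounding:
  fixes p :: "nat \<Rightarrow> 'a \<Rightarrow> real" and l :: "nat \<Rightarrow> 'a \<Rightarrow> real"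
    and c :: "nat \<Rightarrow> nat \<Rightarrow> 'a \<Rightarrow> 'a \<Rightarrow> real"
  assumes "finite I" and "\<And>j i. p j i \<ge> 0" and "\<And>j. j < n \<Longrightarrow> (\<Sum>i\<in>I. p j i) = 1"
  shows "\<exists>f\<in>{..<n} \<rightarrow>\<^sub>E I.
    (\<Sum>b<n. l b (f b)) + (\<Sum>b<n. \<Sum>a<b. c a b (f a) (f b))
      \<le> (\<Sum>b<n. \<Sum>i\<in>I. p b i * l b i)
        + (\<Sum>b<n. \<Sum>a<b. \<Sum>i\<in>I. \<Sum>i'\<in>I. p a i * p b i' * c a b i i')"
  using assms(3)
proof (induction n arbitrary: l)
  case 0
  then show ?case by auto
next
  case (Suc n)
  \<comment> \<open>\<open>L i'\<close> is the part of the right-hand side that involves coordinate \<open>n\<close>, if the weights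
    \<open>p n\<close> are replaced by the point mass at \<open>i'\<close>.\<close>
  define L where "L i' = l n i' + (\<Sum>a<n. \<Sum>i\<in>I. p a i * c a n i i')" for i'
  have "\<exists>i0\<in>I. L i0 \<le> (\<Sum>i\<in>I. p n i * L i)"
  proof (rule ccontr)
    assume "\<not> ?thesis"
    then have less: "\<And>i. i \<in> I \<Longrightarrow> (\<Sum>i\<in>I. p n i * L i) < L i" by force
    let ?A = "\<Sum>i\<in>I. p n i * L i"
    have one: "(\<Sum>i\<in>I. p n i) = 1" using Suc.prems by simp
    then obtain i1 where i1: "i1 \<in> I" "p n i1 > 0"
      using assms(2)[of n] by (metis order.order_iff_strict sum.neutral zero_neq_one)
    have "?A = (\<Sum>i\<in>I. p n i * ?A)"
      using one by (simp add: sum_distrib_right[symmetric])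
    also have "\<dots> < (\<Sum>i\<in>I. p n i * L i)"
    proof (rule sum_strict_mono_ex1)
      show "\<forall>i\<in>I. p n i * ?A \<le> p n i * L i"
        using less assms(2) by (simp add: less_imp_le mult_left_mono)
      show "\<exists>i\<in>I. p n i * ?A < p n i * L i"
        using i1 less by (intro bexI[of _ i1]) auto
    qed (rule assms(1))
    finally show False by simp
  qed
  then obtain i0 where i0: "i0 \<in> I" "L i0 \<le> (\<Sum>i\<in>I. p n i * L i)" by blast
  \<comment> \<open>Once coordinate \<open>n\<close> is fixed, its interaction with each earlier coordinate is a linear term.\<close>
  define l' where "l' b i = l b i + c b n i i0" for b i
  obtain f where f: "f \<in> {..<n} \<rightarrow>\<^sub>E I"
    and le: "(\<Sum>b<n. l' b (f b)) + (\<Sum>b<n. \<Sum>a<b. c a b (f a) (f b))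
      \<le> (\<Sum>b<n. \<Sum>i\<in>I. p b i * l' b i)
        + (\<Sum>b<n. \<Sum>a<b. \<Sum>i\<in>I. \<Sum>i'\<in>I. p a i * p b i' * c a b i i')"
    using Suc.IH[of l'] Suc.prems by (meson less_Suc_eq)
  let ?g = "f(n := i0)"
  have g: "?g \<in> {..<Suc n} \<rightarrow>\<^sub>E I"
    using f i0(1) by (auto simp: PiE_iff extensional_def less_Suc_eq)
  have lin: "(\<Sum>b<Suc n. l b (?g b)) = (\<Sum>b<n. l b (f b)) + l n i0" by simp
  have quad: "(\<Sum>b<Suc n. \<Sum>a<b. c a b (?g a) (?g b))
      = (\<Sum>b<n. \<Sum>a<b. c a b (f a) (f b)) + (\<Sum>a<n. c a n (f a) i0)"
    by simp
  have split: "(\<Sum>b<n. l' b (f b)) = (\<Sum>b<n. l b (f b)) + (\<Sum>a<n. c a n (f a) i0)"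
    by (simp add: l'_def sum.distrib)
  have avg: "(\<Sum>b<n. \<Sum>i\<in>I. p b i * l' b i)
      = (\<Sum>b<n. \<Sum>i\<in>I. p b i * l b i) + (\<Sum>a<n. \<Sum>i\<in>I. p a i * c a n i i0)"
    by (simp add: l'_def sum.distrib distrib_left)
  have "(\<Sum>i'\<in>I. p n i' * (\<Sum>a<n. \<Sum>i\<in>I. p a i * c a n i i'))
      = (\<Sum>a<n. \<Sum>i\<in>I. \<Sum>i'\<in>I. p a i * p n i' * c a n i i')"
    unfolding sum_distrib_left
    by (subst sum.swap, rule sum.cong[OF refl], subst sum.swap) (simp add: ac_simps)
  then have last: "(\<Sum>i\<in>I. p n i * L i) = (\<Sum>i\<in>I. p n i * l n i)
      + (\<Sum>a<n. \<Sum>i\<in>I. \<Sum>i'\<in>I. p a i * p n i' * c a n i i')"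
    by (simp add: L_def distrib_left sum.distrib)
  have Li0: "L i0 = l n i0 + (\<Sum>a<n. \<Sum>i\<in>I. p a i * c a n i i0)"
    by (simp add: L_def)
  have "(\<Sum>b<Suc n. l b (?g b)) + (\<Sum>b<Suc n. \<Sum>a<b. c a b (?g a) (?g b))
      \<le> (\<Sum>b<Suc n. \<Sum>i\<in>I. p b i * l b i)
        + (\<Sum>b<Suc n. \<Sum>a<b. \<Sum>i\<in>I. \<Sum>i'\<in>I. p a i * p b i' * c a b i i')"
    using le i0(2) unfolding last Li0 split avg lin quad by simp
  then show ?case using g by blast
qed

section \<open>Packing and counting sets of edges\<close>

text \<open>
  A maximal separated family must have every element of \<open>X\<close> near one of its members.
\<close>

lemma exists_separated_subfamily:
  fixes b :: real
  assumes "finite X" and sym: "\<And>x y. R x y \<Longrightarrow> R y x" and refl: "\<And>x. x \<in> X \<Longrightarrow> R x x"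
    and few: "\<And>x. x \<in> X \<Longrightarrow> card {y \<in> X. R x y} \<le> b"
  shows "\<exists>F\<subseteq>X. (\<forall>x\<in>F. \<forall>y\<in>F. x \<noteq> y \<longrightarrow> \<not> R x y) \<and> card X \<le> card F * b"
proof -
  define \<F> where "\<F> = {F. F \<subseteq> X \<and> (\<forall>x\<in>F. \<forall>y\<in>F. x \<noteq> y \<longrightarrow> \<not> R x y)}"
  have "finite \<F>" "\<F> \<noteq> {}" using assms(1) unfolding \<F>_def by auto
  then obtain F where F: "F \<in> \<F>" and max: "\<And>F'. F' \<in> \<F> \<Longrightarrow> F \<subseteq> F' \<Longrightarrow> F = F'"
    using finite_has_maximal[of \<F>] by metis
  have sub: "F \<subseteq> X" and fin: "finite F"
    using F assms(1) unfolding \<F>_def by (auto intro: finite_subset)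
  have "X \<subseteq> (\<Union>x\<in>F. {y \<in> X. R x y})"
  proof
    fix y assume y: "y \<in> X"
    show "y \<in> (\<Union>x\<in>F. {y \<in> X. R x y})"
    proof (rule ccontr)
      assume n: "y \<notin> (\<Union>x\<in>F. {y \<in> X. R x y})"
      then have "insert y F \<in> \<F>" using F y sym unfolding \<F>_def by auto
      then have "y \<in> F" using max[of "insert y F"] by blast
      then show False using n y refl by blast
    qed
  qed
  then have "card X \<le> card (\<Union>x\<in>F. {y \<in> X. R x y})"
    using assms(1) fin by (intro card_mono) auto
  also have "\<dots> \<le> (\<Sum>x\<in>F. card {y \<in> X. R x y})" using fin by (rule card_UN_le)
  finally have "real (card X) \<le> (\<Sum>x\<in>F. real (card {y \<in> X. R x y}))"
    by (simp flip: of_nat_sum)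
  also have "\<dots> \<le> card F * b"
    using sub few by (intro sum_bounded_above) blast
  finally have "card X \<le> card F * b" .
  moreover have "F \<subseteq> X \<and> (\<forall>x\<in>F. \<forall>y\<in>F. x \<noteq> y \<longrightarrow> \<not> R x y)"
    using F unfolding \<F>_def by simp
  ultimately show ?thesis by meson
qed

text \<open>
  The number of sets \<open>D\<close> (differences between \<open>S\<close> and \<open>T\<close>) with at most \<open>r\<close> elements is bounded by the
  exponential moment method: each is given weight \<open>4 ^ (r - card D)\<close>. The base 4 is chosen
  because \<open>(5/4)\<^sup>2 < 2\<close>, which is all that the final estimate needs.
\<close>

lemma card_hamming_ball_le:
  fixes r :: nat
  assumes "finite E" "T \<subseteq> E"
  shows "real (card {S. S \<subseteq> E \<and> card {e \<in> E. (e \<in> T) \<noteq> (e \<in> S)} \<le> r}) \<le> 4 ^ r * (5 / 4) ^ card E"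
proof -
  let ?B = "{S. S \<subseteq> E \<and> card {e \<in> E. (e \<in> T) \<noteq> (e \<in> S)} \<le> r}"
  let ?D = "{D \<in> Pow E. card D \<le> r}"
  have fin: "finite ?D" using assms(1) by simp
  have "card ?B \<le> card ?D"
  proof (rule card_inj_on_le[OF _ _ fin])
    show "inj_on (\<lambda>S. {e \<in> E. (e \<in> T) \<noteq> (e \<in> S)}) ?B"
      by (rule inj_onI) blast
  qed auto
  also have "real (card ?D) = (\<Sum>D\<in>?D. 1)" by simp
  \<comment> \<open>Weights that are at least 1 on the sets with at most \<open>r\<close> elements, and sum to a product over all sets.\<close>
  also have "\<dots> \<le> (\<Sum>D\<in>?D. 4 ^ r * (1 / 4) ^ card D)"
  proof (rule sum_mono)
    fix D assume "D \<in> ?D"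
    then have "(4::real) ^ card D \<le> 4 ^ r" by (intro power_increasing) auto
    then show "1 \<le> (4::real) ^ r * (1 / 4) ^ card D"
      by (simp add: power_divide field_simps)
  qed
  also have "\<dots> \<le> (\<Sum>D\<in>Pow E. 4 ^ r * (1 / 4) ^ card D)"
    using assms(1) by (intro sum_mono2) auto
  also have "\<dots> = 4 ^ r * (\<Prod>e\<in>E. 1 / 4 + 1)"
    using prod_add[OF assms(1), of "\<lambda>_. 1/4::real" "\<lambda>_. 1"] by (simp add: sum_distrib_left)
  also have "\<dots> = 4 ^ r * (5 / 4) ^ card E" by simp
  finally show ?thesis by simp
qed

text \<open>
  With \<open>n = 64 * k\<close>, the three factors in parentheses bound the number of vertex maps and the size of a
  Hamming ball of radius \<open>64 * k\<^sup>2\<close>. The base 2 logarithm of the right-hand side is about \<open>2048 * k\<^sup>2\<close>; the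
  last factor accounts for at most half of this, and the others for a few hundred times \<open>k\<^sup>2\<close>.
\<close>

lemma counting_estimate:
  assumes "k \<ge> 1"
  shows "(2::real) ^ k\<^sup>2 * ((64 * real k + 1) ^ (64 * k) * 4 ^ (64 * k\<^sup>2) * (5 / 4) ^ ((64 * k) choose 2))
    \<le> 2 ^ ((64 * k) choose 2)"
proof -
  define h where "h = 16 * k * (64 * k - 1)"
  have choose: "(64 * k) choose 2 = 2 * h"
  proof -
    have "64 * k * (64 * k - 1) = 2 * (2 * h)" unfolding h_def by (simp add: algebra_simps)
    then show ?thesis unfolding choose_two by simp
  qed
  have "h + 16 * k = 1024 * k\<^sup>2"
    using assms unfolding h_def by (cases k) (auto simp: power2_eq_square algebra_simps)
  moreover have "k \<le> k\<^sup>2" using assms by (simp add: power2_eq_square)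
  moreover have "k\<^sup>2 + (7 + k) * (64 * k) + 2 * (64 * k\<^sup>2) = 193 * k\<^sup>2 + 448 * k"
    by (simp add: power2_eq_square algebra_simps)
  ultimately have exponent: "k\<^sup>2 + (7 + k) * (64 * k) + 2 * (64 * k\<^sup>2) + h \<le> 2 * h"
    by linarith
  have "64 * k + 1 \<le> 2 ^ 7 * k" using assms by simp
  also have "\<dots> \<le> 2 ^ 7 * 2 ^ k" by (intro mult_left_mono less_imp_le[OF less_exp]) simp
  finally have "64 * k + 1 \<le> 2 ^ (7 + k)" by (simp only: power_add)
  then have "real (64 * k + 1) \<le> real (2 ^ (7 + k))" by (simp only: of_nat_le_iff)
  then have "64 * real k + 1 \<le> 2 ^ (7 + k)" by simp
  then have maps: "(64 * real k + 1) ^ (64 * k) \<le> 2 ^ ((7 + k) * (64 * k))"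
    by (subst power_mult) (intro power_mono, auto)
  have four: "(4::real) ^ (64 * k\<^sup>2) = 2 ^ (2 * (64 * k\<^sup>2))"
    by (subst power_mult) simp
  have "(5 / 4 :: real) ^ (2 * h) = (25 / 16) ^ h"
    by (subst power_mult) (simp add: power2_eq_square)
  also have "\<dots> \<le> 2 ^ h" by (intro power_mono) auto
  finally have ball: "(5 / 4 :: real) ^ (2 * h) \<le> 2 ^ h" .
  have "(2::real) ^ k\<^sup>2 * ((64 * real k + 1) ^ (64 * k) * 4 ^ (64 * k\<^sup>2) * (5 / 4) ^ (2 * h))
      \<le> 2 ^ k\<^sup>2 * (2 ^ ((7 + k) * (64 * k)) * 2 ^ (2 * (64 * k\<^sup>2)) * 2 ^ h)"
    using maps four ball by (intro mult_mono) simp_all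
  also have "\<dots> = 2 ^ (k\<^sup>2 + (7 + k) * (64 * k) + 2 * (64 * k\<^sup>2) + h)"
    by (simp only: power_add mult.assoc)
  also have "\<dots> \<le> 2 ^ (2 * h)"
    using exponent by (intro power_increasing) auto
  finally show ?thesis unfolding choose .
qed

section \<open>Lebesgue measure on products\<close>

text \<open>
  Each factor differs from a Borel set by part of a null set, and a strip over a null set is null,
  so the product differs negligibly from a product of Borel sets.
\<close>

lemma lebesgue_Times:
  fixes A :: "'a::euclidean_space set" and B :: "'b::euclidean_space set"
  assumes "A \<in> sets lebesgue" "B \<in> sets lebesgue"
  shows "A \<times> B \<in> sets lebesgue"
    and "emeasure lebesgue (A \<times> B) = emeasure lebesgue A * emeasure lebesgue B"
proof -
  obtain NA NB where N: "NA \<in> null_sets lborel" "null_part lborel A \<subseteq> NA"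
      "NB \<in> null_sets lborel" "null_part lborel B \<subseteq> NB"
    using null_part assms by meson
  define A0 B0 where "A0 = main_part lborel A" and "B0 = main_part lborel B"
  have borel: "A0 \<in> sets lborel" "B0 \<in> sets lborel"
    unfolding A0_def B0_def by (rule main_part_sets[OF assms(1)], rule main_part_sets[OF assms(2)])
  have A: "A = A0 \<union> null_part lborel A" and B: "B = B0 \<union> null_part lborel B"
    unfolding A0_def B0_def using assms by (simp_all add: main_part_null_part_Un)
  have prod: "X \<times> Y \<in> sets lborel \<and> emeasure lborel (X \<times> Y) = emeasure lborel X * emeasure lborel Y"
    if "X \<in> sets lborel" "Y \<in> sets lborel" for X :: "'a set" and Y :: "'b set"
    using that lborel.emeasure_pair_measure_Times[of X lborel Y] pair_measureI[of X lborel Y lborel]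
    by (simp only: lborel_prod)
  let ?N = "NA \<times> UNIV \<union> UNIV \<times> NB"
  have "NA \<times> (UNIV :: 'b set) \<in> null_sets lborel" "(UNIV :: 'a set) \<times> NB \<in> null_sets lborel"
    using prod[of NA UNIV] prod[of UNIV NB] N by (auto simp: null_sets_def)
  then have null: "?N \<in> null_sets lborel" by (rule null_sets.Un)
  have decomp: "A \<times> B = A0 \<times> B0 \<union> (A \<times> B - A0 \<times> B0)" and sub: "A \<times> B - A0 \<times> B0 \<subseteq> ?N"
    using A B N by auto
  show meas: "A \<times> B \<in> sets lebesgue"
    using prod[OF borel] by (intro sets_completionI[OF decomp sub null]) simp
  have "A \<times> B - A0 \<times> B0 \<in> null_sets lebesgue"
    by (rule null_sets_completion_subset[OF sub null_sets_completionI[OF null]])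
  then have "emeasure lebesgue (A \<times> B) = emeasure lebesgue (A0 \<times> B0)"
    using prod[OF borel] by (subst decomp) (rule emeasure_Un_null_set, auto intro: sets_completionI_sets)
  also have "\<dots> = emeasure lborel A0 * emeasure lborel B0"
    using prod[OF borel] by simp
  also have "\<dots> = emeasure lebesgue A * emeasure lebesgue B"
    unfolding A0_def B0_def using assms by (simp add: emeasure_completion)
  finally show "emeasure lebesgue (A \<times> B) = emeasure lebesgue A * emeasure lebesgue B" .
qed

lemma measure_lebesgue_Times:
  fixes A :: "'a::euclidean_space set" and B :: "'b::euclidean_space set"
  assumes "A \<in> sets lebesgue" "B \<in> sets lebesgue"
  shows "measure lebesgue (A \<times> B) = measure lebesgue A * measure lebesgue B"
  using lebesgue_Times(2)[OF assms] by (simp add: measure_def enn2real_mult)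

lemma measurable_projections_lebesgue_on:
  fixes S :: "'a::euclidean_space set" and T :: "'b::euclidean_space set"
  assumes "S \<in> sets lebesgue" "T \<in> sets lebesgue"
  shows "fst \<in> lebesgue_on (S \<times> T) \<rightarrow>\<^sub>M lebesgue_on S"
    and "snd \<in> lebesgue_on (S \<times> T) \<rightarrow>\<^sub>M lebesgue_on T"
proof -
  have ST: "S \<times> T \<in> sets lebesgue" using assms by (rule lebesgue_Times)
  show "fst \<in> lebesgue_on (S \<times> T) \<rightarrow>\<^sub>M lebesgue_on S"
  proof (rule measurableI)
    fix A assume "A \<in> sets (lebesgue_on S)"
    then have A: "A \<in> sets lebesgue" "A \<subseteq> S" using assms by (auto simp: sets_restrict_space_iff)
    moreover have "fst -` A \<inter> space (lebesgue_on (S \<times> T)) = A \<times> T" using A by auto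
    ultimately show "fst -` A \<inter> space (lebesgue_on (S \<times> T)) \<in> sets (lebesgue_on (S \<times> T))"
      using assms ST lebesgue_Times(1)[of A T] by (auto simp: sets_restrict_space_iff)
  qed auto
  show "snd \<in> lebesgue_on (S \<times> T) \<rightarrow>\<^sub>M lebesgue_on T"
  proof (rule measurableI)
    fix A assume "A \<in> sets (lebesgue_on T)"
    then have A: "A \<in> sets lebesgue" "A \<subseteq> T" using assms by (auto simp: sets_restrict_space_iff)
    moreover have "snd -` A \<inter> space (lebesgue_on (S \<times> T)) = S \<times> A" using A by auto
    ultimately show "snd -` A \<inter> space (lebesgue_on (S \<times> T)) \<in> sets (lebesgue_on (S \<times> T))"
      using assms ST lebesgue_Times(1)[of S A] by (auto simp: sets_restrict_space_iff)
  qed auto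
qed

lemma lmeasurable_square: "unit_itv \<times> unit_itv \<in> lmeasurable"
  by (simp add: compact_Times lmeasurable_compact)

lemma finite_measure_square: "finite_measure (lebesgue_on (unit_itv \<times> unit_itv))"
  using lmeasurable_square by (rule finite_measure_lebesgue_on)

section \<open>Measure preserving maps and disjoint balls\<close>

lemma measure_preserving_maps_D:
  assumes "\<phi> \<in> measure_preserving_maps"
  shows "\<phi> \<in> borel_measurable (lebesgue_on unit_itv)"
    and "x \<in> unit_itv \<Longrightarrow> \<phi> x \<in> unit_itv"
    and "A \<in> sets borel \<Longrightarrow>
      measure lebesgue {x \<in> unit_itv. \<phi> x \<in> A} = measure lebesgue (unit_itv \<inter> A)"
proof -
  let ?M = "lebesgue_on unit_itv"
  have meas: "\<phi> \<in> ?M \<rightarrow>\<^sub>M ?M" and dist: "distr ?M ?M \<phi> = ?M"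
    using assms by (auto simp: measure_preserving_maps_def)
  have "(\<lambda>x. x) \<in> borel_measurable ?M"
    by (intro measurable_restrict_space1 measurable_completion) simp
  from measurable_compose[OF meas this] show "\<phi> \<in> borel_measurable ?M" .
  have range: "\<phi> x \<in> unit_itv" if "x \<in> unit_itv" for x
    using measurable_space[OF meas] that by (simp only: space_lebesgue_on)
  then show "x \<in> unit_itv \<Longrightarrow> \<phi> x \<in> unit_itv" .
  assume A: "A \<in> sets borel"
  have UA: "unit_itv \<inter> A \<in> sets ?M"
    using A by (simp add: sets_restrict_space_iff)
  have vim: "\<phi> -` (unit_itv \<inter> A) \<inter> space ?M = {x \<in> unit_itv. \<phi> x \<in> A}"
    unfolding space_lebesgue_on using range by blast
  have "measure lebesgue {x \<in> unit_itv. \<phi> x \<in> A} = measure ?M {x \<in> unit_itv. \<phi> x \<in> A}"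
    by (intro measure_restrict_space[symmetric]) auto
  also have "\<dots> = measure (distr ?M ?M \<phi>) (unit_itv \<inter> A)"
    using measure_distr[OF meas UA] vim by simp
  also have "\<dots> = measure lebesgue (unit_itv \<inter> A)"
    unfolding dist by (intro measure_restrict_space) auto
  finally show "measure lebesgue {x \<in> unit_itv. \<phi> x \<in> A} = measure lebesgue (unit_itv \<inter> A)" .
qed

lemma id_measure_preserving: "(\<lambda>x. x) \<in> measure_preserving_maps"
  by (simp add: measure_preserving_maps_def distr_id2)

text \<open>
  Borel measurability of \<open>W\<close> is assumed since the composition of a Lebesgue measurable function with
  another measurable map need not be measurable.
\<close>

lemma measurable_pullback:
  assumes W: "(\<lambda>(x, y). W x y) \<in> borel_measurable borel"
    and \<phi>: "\<phi> \<in> measure_preserving_maps"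
  shows "(\<lambda>(x, y). pullback W \<phi> x y) \<in> borel_measurable (lebesgue_on (unit_itv \<times> unit_itv))"
proof -
  let ?M = "lebesgue_on (unit_itv \<times> unit_itv)"
  have "(\<lambda>z. \<phi> (fst z)) \<in> borel_measurable ?M" "(\<lambda>z. \<phi> (snd z)) \<in> borel_measurable ?M"
    by (rule measurable_compose[OF measurable_projections_lebesgue_on(1)]
             measurable_compose[OF measurable_projections_lebesgue_on(2)];
        use measure_preserving_maps_D(1)[OF \<phi>] in simp)+
  then have "(\<lambda>z. (\<phi> (fst z), \<phi> (snd z))) \<in> borel_measurable ?M"
    by (rule borel_measurable_Pair)
  from measurable_compose[OF this W] show ?thesis
    by (simp add: pullback_def case_prod_unfold)
qed

lemma graphon_range:
  assumes "graphon W" "x \<in> unit_itv" "y \<in> unit_itv"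
  shows "W x y \<in> unit_itv"
  using assms by (simp add: graphon_def)

lemma L2_norm_nonneg: "L2_norm f \<ge> 0"
  by (simp add: L2_norm_def case_prod_unfold)

lemma delta2_less_imp_pullback_close:
  assumes "delta2 W U < \<epsilon>"
  shows "\<exists>\<phi>\<in>measure_preserving_maps.
    (\<integral>(x, y). (pullback W \<phi> x y - U x y)\<^sup>2 \<partial>lebesgue_on (unit_itv \<times> unit_itv)) < \<epsilon>\<^sup>2"
proof -
  have "bdd_below ((\<lambda>\<phi>. L2_norm (\<lambda>x y. pullback W \<phi> x y - U x y)) ` measure_preserving_maps)"
    by (intro bdd_belowI2[of _ 0] L2_norm_nonneg)
  then obtain \<phi> where \<phi>: "\<phi> \<in> measure_preserving_maps"
      "L2_norm (\<lambda>x y. pullback W \<phi> x y - U x y) < \<epsilon>"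
    using assms id_measure_preserving cINF_less_iff[of measure_preserving_maps] unfolding delta2_def
    by blast
  let ?I = "\<integral>(x, y). (pullback W \<phi> x y - U x y)\<^sup>2 \<partial>lebesgue_on (unit_itv \<times> unit_itv)"
  have "?I \<ge> 0" by (simp add: case_prod_unfold)
  moreover have "(sqrt ?I)\<^sup>2 < \<epsilon>\<^sup>2"
    using \<phi>(2) \<open>?I \<ge> 0\<close> unfolding L2_norm_def by (intro power_strict_mono) auto
  ultimately have "?I < \<epsilon>\<^sup>2" by simp
  then show ?thesis using \<phi>(1) by blast
qed

lemma delta2_self_le: "delta2 W W \<le> 0"
proof -
  have "bdd_below ((\<lambda>\<phi>. L2_norm (\<lambda>x y. pullback W \<phi> x y - W x y)) ` measure_preserving_maps)"
    by (intro bdd_belowI2[of _ 0] L2_norm_nonneg)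
  then have "delta2 W W \<le> L2_norm (\<lambda>x y. pullback W (\<lambda>x. x) x y - W x y)"
    unfolding delta2_def by (rule cINF_lower) (rule id_measure_preserving)
  also have "\<dots> = 0" by (simp add: L2_norm_def pullback_def case_prod_unfold)
  finally show ?thesis .
qed

lemma integrable_sqdiff:
  fixes f g :: "real \<times> real \<Rightarrow> real"
  defines "M \<equiv> lebesgue_on (unit_itv \<times> unit_itv)"
  assumes "f \<in> borel_measurable M" "g \<in> borel_measurable M"
    and "\<And>z. z \<in> unit_itv \<times> unit_itv \<Longrightarrow> f z \<in> unit_itv \<and> g z \<in> unit_itv"
  shows "integrable M (\<lambda>z. (f z - g z)\<^sup>2)"
proof (rule finite_measure.integrable_const_bound[where B = 1])
  show "finite_measure M" unfolding M_def by (rule finite_measure_square)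
  have "norm ((f z - g z)\<^sup>2) \<le> 1" if "z \<in> unit_itv \<times> unit_itv" for z
  proof -
    have "\<bar>f z - g z\<bar> \<le> 1" using assms(4)[OF that] by auto
    then show ?thesis by (simp add: abs_square_le_1)
  qed
  then show "AE z in M. norm ((f z - g z)\<^sup>2) \<le> 1"
    unfolding M_def by (intro AE_I2) auto
qed (use assms(2,3) in measurable)

text \<open>
  The definition of \<open>delta2\<close> pulls back only its first argument. If balls around \<open>w i\<close> and \<open>w j\<close> had
  a common point \<open>U\<close>, then a pullback of \<open>w i\<close> and a pullback of \<open>w j\<close> would both be close to the same
  \<open>U\<close>, hence to each other. So disjointness follows from the separation of all pairs of pullbacks.
  The constant 4 comes from \<open>(a - b)\<^sup>2 \<le> 2 * (a - u)\<^sup>2 + 2 * (b - u)\<^sup>2\<close>, integrated over the square.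
\<close>

lemma packing_number_ge_card:
  fixes w :: "'a \<Rightarrow> real \<Rightarrow> real \<Rightarrow> real"
  assumes F: "finite F" and "\<epsilon> > 0"
    and w: "\<And>i. i \<in> F \<Longrightarrow> w i \<in> graphons_upto \<rho>"
    and borel: "\<And>i. i \<in> F \<Longrightarrow> (\<lambda>(x, y). w i x y) \<in> borel_measurable borel"
    and sep: "\<And>i j \<phi> \<psi>. i \<in> F \<Longrightarrow> j \<in> F \<Longrightarrow> i \<noteq> j \<Longrightarrow>
      \<phi> \<in> measure_preserving_maps \<Longrightarrow> \<psi> \<in> measure_preserving_maps \<Longrightarrow>
      4 * \<epsilon>\<^sup>2 \<le> (\<integral>(x, y). (pullback (w i) \<phi> x y - pullback (w j) \<psi> x y)\<^sup>2
        \<partial>lebesgue_on (unit_itv \<times> unit_itv))"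
  shows "enat (card F) \<le> packing_number (graphons_upto \<rho>) delta2 \<epsilon> (graphons_upto \<rho>)"
proof -
  let ?M = "lebesgue_on (unit_itv \<times> unit_itv)"
  let ?ball = "\<lambda>i. open_ball (graphons_upto \<rho>) delta2 (w i) \<epsilon>"
  have disj: "disjnt (?ball i) (?ball j)" if ij: "i \<in> F" "j \<in> F" "i \<noteq> j" for i j
  proof (rule ccontr)
    assume "\<not> disjnt (?ball i) (?ball j)"
    then obtain U where U: "graphon U" "delta2 (w i) U < \<epsilon>" "delta2 (w j) U < \<epsilon>"
      by (auto simp: disjnt_def open_ball_def graphons_upto_def)
    obtain \<phi> \<psi> where mp: "\<phi> \<in> measure_preserving_maps" "\<psi> \<in> measure_preserving_maps"
      and close: "(\<integral>(x, y). (pullback (w i) \<phi> x y - U x y)\<^sup>2 \<partial>?M) < \<epsilon>\<^sup>2"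
        "(\<integral>(x, y). (pullback (w j) \<psi> x y - U x y)\<^sup>2 \<partial>?M) < \<epsilon>\<^sup>2"
      using delta2_less_imp_pullback_close U by meson
    define f g u where "f = (\<lambda>(x, y). pullback (w i) \<phi> x y)"
      and "g = (\<lambda>(x, y). pullback (w j) \<psi> x y)" and "u = (\<lambda>(x, y). U x y)"
    have meas: "f \<in> borel_measurable ?M" "g \<in> borel_measurable ?M" "u \<in> borel_measurable ?M"
      unfolding f_def g_def u_def using measurable_pullback[OF borel[OF ij(1)] mp(1)]
        measurable_pullback[OF borel[OF ij(2)] mp(2)] U(1)[unfolded graphon_def] by simp_all
    have val: "f z \<in> unit_itv \<and> g z \<in> unit_itv \<and> u z \<in> unit_itv" if zU: "z \<in> unit_itv \<times> unit_itv" for z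
    proof -
      obtain x y where z: "z = (x, y)" "x \<in> unit_itv" "y \<in> unit_itv"
        using zU by (rule SigmaE)
      have "graphon (w i)" "graphon (w j)" using w ij by (simp_all add: graphons_upto_def)
      then show ?thesis
        unfolding f_def g_def u_def z(1) pullback_def prod.case
        using graphon_range U(1) z(2,3) measure_preserving_maps_D(2)[OF mp(1)]
          measure_preserving_maps_D(2)[OF mp(2)] by blast
    qed
    have int: "integrable ?M (\<lambda>z. (f z - g z)\<^sup>2)" "integrable ?M (\<lambda>z. (f z - u z)\<^sup>2)"
        "integrable ?M (\<lambda>z. (g z - u z)\<^sup>2)"
      by (rule integrable_sqdiff; use meas val in blast)+
    have "(\<integral>z. (f z - g z)\<^sup>2 \<partial>?M) \<le> (\<integral>z. 2 * (f z - u z)\<^sup>2 + 2 * (g z - u z)\<^sup>2 \<partial>?M)"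
    proof (rule integral_mono)
      fix z
      have "0 \<le> ((f z - u z) + (g z - u z))\<^sup>2" by simp
      then show "(f z - g z)\<^sup>2 \<le> 2 * (f z - u z)\<^sup>2 + 2 * (g z - u z)\<^sup>2"
        by (simp add: power2_eq_square algebra_simps)
    qed (use int in auto)
    also have "\<dots> = 2 * (\<integral>z. (f z - u z)\<^sup>2 \<partial>?M) + 2 * (\<integral>z. (g z - u z)\<^sup>2 \<partial>?M)"
      using int by simp
    also have "\<dots> < 4 * \<epsilon>\<^sup>2"
      using close by (simp add: f_def g_def u_def case_prod_unfold)
    finally show False
      using sep[OF ij mp] by (simp add: f_def g_def case_prod_unfold)
  qed
  \<comment> \<open>Disjoint balls could still coincide if they were empty, so the centres are needed to count them.\<close>
  have center: "w i \<in> ?ball i" if "i \<in> F" for i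
    using w[OF that] delta2_self_le[of "w i"] \<open>\<epsilon> > 0\<close> by (auto simp: open_ball_def)
  have inj: "inj_on ?ball F"
  proof (rule inj_onI, rule ccontr)
    fix i j assume ij: "i \<in> F" "j \<in> F" "?ball i = ?ball j" "i \<noteq> j"
    then have "disjnt (?ball i) (?ball i)" using disj by metis
    then show False using center[OF ij(1)] by (auto simp: disjnt_def)
  qed
  let ?\<B> = "?ball ` F"
  have "finite ?\<B>" using F by simp
  moreover have "?\<B> \<subseteq> {open_ball (graphons_upto \<rho>) delta2 x \<epsilon> |x. x \<in> graphons_upto \<rho>}"
    using w by blast
  moreover have "\<forall>B\<in>?\<B>. B \<subseteq> graphons_upto \<rho>"
    by (simp add: open_ball_def)
  moreover have "pairwise disjnt ?\<B>"
    using disj by (intro pairwiseI) blast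
  ultimately have "enat (card ?\<B>) \<le> packing_number (graphons_upto \<rho>) delta2 \<epsilon> (graphons_upto \<rho>)"
    unfolding packing_number_def by (intro SUP_upper) simp
  then show ?thesis using card_image[OF inj] by simp
qed

section \<open>Step graphons of graphs\<close>

text \<open>
  On \<open>{0..<1}\<close> this is the index of the interval of length \<open>1 / n\<close> that contains \<open>x\<close>. The point 1 has
  the index \<open>n\<close>, which lies outside the vertex set \<open>{..<n}\<close>.
\<close>

definition cell :: "nat \<Rightarrow> real \<Rightarrow> nat" where
  "cell n x = nat \<lfloor>real n * x\<rfloor>"

lemma measurable_cell [measurable]: "cell n \<in> borel \<rightarrow>\<^sub>M count_space UNIV"
  unfolding cell_def by measurable

lemma cell_eq_iff:
  assumes "0 \<le> x" "n > 0"
  shows "cell n x = j \<longleftrightarrow> real j / n \<le> x \<and> x < (real j + 1) / n"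
proof -
  have "cell n x = j \<longleftrightarrow> \<lfloor>real n * x\<rfloor> = int j"
    using assms by (auto simp: cell_def)
  also have "\<dots> \<longleftrightarrow> real j \<le> real n * x \<and> real n * x < real j + 1"
    by (simp add: floor_eq_iff)
  finally show ?thesis using assms by (simp add: field_simps)
qed

lemma cell_le: "x \<in> unit_itv \<Longrightarrow> cell n x \<le> n"
proof -
  assume "x \<in> unit_itv"
  then have "real n * x \<le> real n" by (simp add: mult_left_le)
  then show ?thesis unfolding cell_def by linarith
qed

lemma measure_cell:
  assumes "j < n"
  shows "measure lebesgue (unit_itv \<inter> cell n -` {j}) = 1 / n"
proof -
  have "real j + 1 \<le> real n" using assms by linarith
  then have le: "(real j + 1) / n \<le> 1" by simp
  have "unit_itv \<inter> cell n -` {j} = {real j / n ..< (real j + 1) / n}"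
  proof (intro set_eqI iffI)
    fix x assume x: "x \<in> {real j / real n ..< (real j + 1) / real n}"
    then have "0 \<le> x" by (auto intro: order_trans[rotated])
    moreover have "x \<le> 1" using x le by simp
    ultimately show "x \<in> unit_itv \<inter> cell n -` {j}" using x assms cell_eq_iff[of x n j] by simp
  next
    fix x assume "x \<in> unit_itv \<inter> cell n -` {j}"
    then show "x \<in> {real j / real n ..< (real j + 1) / real n}"
      using assms cell_eq_iff[of x n j] by simp
  qed
  moreover have "real j / n \<le> (real j + 1) / n" by (simp add: divide_right_mono)
  ultimately show ?thesis by (simp add: diff_divide_distrib[symmetric])
qed

definition complete_graph :: "nat \<Rightarrow> nat set set" where
  "complete_graph n = {e. e \<subseteq> {..<n} \<and> card e = 2}"

lemma card_complete_graph: "card (complete_graph n) = n choose 2"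
  unfolding complete_graph_def using n_subsets[of "{..<n}" 2] by simp

lemma card_edges_le_sum:
  "real (card {e \<in> complete_graph n. P e}) \<le> (\<Sum>b<n. \<Sum>a<b. of_bool (P {a, b}))"
proof -
  let ?T = "{(b, a). b < n \<and> a < b \<and> P {a, b}}"
  have T: "?T = (SIGMA b:{..<n}. {a \<in> {..<b}. P {a, b}})" by auto
  have "{e \<in> complete_graph n. P e} \<subseteq> (\<lambda>(b, a). {a, b}) ` ?T"
  proof
    fix e assume e: "e \<in> {e \<in> complete_graph n. P e}"
    then obtain a b where "e = {a, b}" "a \<noteq> b" by (auto simp: complete_graph_def card_2_iff)
    then have "\<exists>a b. e = {a, b} \<and> a < b"
      by (metis insert_commute linorder_neqE_nat)
    then obtain a b where "e = {a, b}" "a < b" by blast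
    then show "e \<in> (\<lambda>(b, a). {a, b}) ` ?T" using e by (auto simp: complete_graph_def)
  qed
  then have "card {e \<in> complete_graph n. P e} \<le> card ?T"
    unfolding T by (rule surj_card_le[rotated]) simp
  also have "\<dots> = (\<Sum>b<n. \<Sum>a<b. of_bool (P {a, b}))"
    unfolding T by (simp add: of_bool_def sum.If_cases Int_def)
  finally show ?thesis by (simp add: of_nat_mono[where 'a=real] flip: of_nat_sum)
qed

text \<open>
  Since a graph is a set of unordered pairs, the graphon is symmetric by construction.
\<close>

definition graph_graphon :: "real \<Rightarrow> nat \<Rightarrow> nat set set \<Rightarrow> real \<Rightarrow> real \<Rightarrow> real" where
  "graph_graphon \<rho> n G x y = (if {cell n x, cell n y} \<in> G then \<rho> else 0)"

lemma graph_graphon_in_graphons_upto: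
  assumes "0 \<le> \<rho>" "\<rho> \<le> 1"
  shows "(\<lambda>(x, y). graph_graphon \<rho> n G x y) \<in> borel_measurable borel"
    and "graph_graphon \<rho> n G \<in> graphons_upto \<rho>"
proof -
  have [measurable]: "(\<lambda>z::real\<times>real. cell n (fst z)) \<in> borel \<rightarrow>\<^sub>M count_space UNIV"
    "(\<lambda>z::real\<times>real. cell n (snd z)) \<in> borel \<rightarrow>\<^sub>M count_space UNIV"
    by (simp_all add: borel_prod[symmetric])
  have "(\<lambda>(x, y). graph_graphon \<rho> n G x y)
      = (\<lambda>z. if \<exists>i j. cell n (fst z) = i \<and> cell n (snd z) = j \<and> {i, j} \<in> G then \<rho> else 0)"
    by (auto simp: graph_graphon_def fun_eq_iff)
  also have "\<dots> \<in> borel_measurable borel" by measurable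
  finally show borel: "(\<lambda>(x, y). graph_graphon \<rho> n G x y) \<in> borel_measurable borel" .
  have "(\<lambda>(x, y). graph_graphon \<rho> n G x y) \<in> borel_measurable (lebesgue_on (unit_itv \<times> unit_itv))"
    using borel by (intro measurable_restrict_space1 measurable_completion) simp
  moreover have "graph_graphon \<rho> n G x y = graph_graphon \<rho> n G y x
      \<and> 0 \<le> graph_graphon \<rho> n G x y \<and> graph_graphon \<rho> n G x y \<le> 1" for x y
    using assms by (simp add: graph_graphon_def insert_commute)
  ultimately have "graphon (graph_graphon \<rho> n G)"
    unfolding graphon_def by blast
  then show "graph_graphon \<rho> n G \<in> graphons_upto \<rho>"
    using assms by (simp add: graphons_upto_def graph_graphon_def)
qed

text \<open>
  A pair of measure preserving maps couples the vertices of \<open>G\<close> with those of \<open>G'\<close> fractionally, and the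
  squared distance is, up to the factor \<open>\<rho>\<^sup>2\<close>, the probability that two independent pairs of coupled
  vertices disagree about being an edge. Conditioning on the vertices of \<open>G'\<close> and rounding the coupling
  gives an honest vertex map \<open>f\<close> whose number of disagreements is bounded by \<open>n\<^sup>2\<close> times that
  probability. This replaces the continuum of pairs of maps by finitely many vertex maps.
\<close>

lemma exists_vertex_map_close:
  fixes \<rho> :: real
  assumes "n > 0" and \<rho>: "0 \<le> \<rho>" "\<rho> \<le> 1"
    and mp: "\<phi> \<in> measure_preserving_maps" "\<psi> \<in> measure_preserving_maps"
  shows "\<exists>f\<in>{..<n} \<rightarrow>\<^sub>E {..n}.
    \<rho>\<^sup>2 * real (card {e \<in> complete_graph n. (f ` e \<in> G) \<noteq> (e \<in> G')}) \<le>
      (real n)\<^sup>2 * (\<integral>(x, y). (pullback (graph_graphon \<rho> n G) \<phi> x y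
        - pullback (graph_graphon \<rho> n G') \<psi> x y)\<^sup>2 \<partial>lebesgue_on (unit_itv \<times> unit_itv))"
proof -
  let ?U = "lebesgue_on unit_itv" and ?M = "lebesgue_on (unit_itv \<times> unit_itv)"
  interpret finite_measure ?M by (rule finite_measure_square)
  define E where "E i j = {s \<in> unit_itv. cell n (\<phi> s) = i \<and> cell n (\<psi> s) = j}" for i j
  have [measurable]: "\<phi> \<in> borel_measurable ?U" "\<psi> \<in> borel_measurable ?U"
    using mp measure_preserving_maps_D(1) by auto
  have "{s \<in> space ?U. cell n (\<phi> s) = i \<and> cell n (\<psi> s) = j} \<in> sets ?U" for i j
    by measurable
  then have E_U: "E i j \<in> sets ?U" for i j by (simp add: E_def)
  then have E_meas: "E i j \<in> sets lebesgue" for i j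
    by (simp add: sets_restrict_space_iff)
  \<comment> \<open>The matrix of measures of the \<open>E i j\<close> couples the two partitions into cells; \<open>p j\<close> is the
    distribution of the first cell conditional on the second one being \<open>j\<close>. The value \<open>n\<close> for \<open>i\<close>
    is needed because \<open>\<phi>\<close> can take the value 1.\<close>
  define p where "p j i = n * measure lebesgue (E i j)" for j i
  have p_nonneg: "0 \<le> p j i" for j i by (simp add: p_def)
  have p_sum: "(\<Sum>i\<le>n. p j i) = 1" if j: "j < n" for j
  proof -
    have fin_U: "finite_measure ?U" by (rule finite_measure_lebesgue_on) simp
    have restrict: "measure ?U A = measure lebesgue A" if "A \<subseteq> unit_itv" for A
      using that by (intro measure_restrict_space) auto
    have union: "(\<Union>i\<in>{..n}. E i j) = {s \<in> unit_itv. \<psi> s \<in> cell n -` {j}}"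
      using measure_preserving_maps_D(2)[OF mp(1)] cell_le by (auto simp: E_def)
    have "(\<Sum>i\<le>n. measure lebesgue (E i j)) = (\<Sum>i\<le>n. measure ?U (E i j))"
      by (intro sum.cong refl restrict[symmetric]) (auto simp: E_def)
    also have "\<dots> = measure ?U (\<Union>i\<in>{..n}. E i j)"
      by (rule finite_measure.finite_measure_finite_Union[OF fin_U, symmetric])
        (use E_U in \<open>auto simp: disjoint_family_on_def E_def\<close>)
    also have "\<dots> = measure lebesgue {s \<in> unit_itv. \<psi> s \<in> cell n -` {j}}"
      unfolding union by (rule restrict) auto
    also have "\<dots> = 1 / n"
      using measure_preserving_maps_D(3)[OF mp(2), of "cell n -` {j}"] measure_cell[OF j]
        measurable_sets[OF measurable_cell, of "{j}" n] by simp
    finally have "(\<Sum>i\<le>n. measure lebesgue (E i j)) = 1 / n" .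
    then show ?thesis using \<open>n > 0\<close> by (simp add: p_def flip: sum_distrib_left)
  qed
  define c where "c a b i i' = (of_bool (({i, i'} \<in> G) \<noteq> ({a, b} \<in> G')) :: real)" for a b i i'
  obtain f where f: "f \<in> {..<n} \<rightarrow>\<^sub>E {..n}"
    and le: "(\<Sum>b<n. \<Sum>a<b. c a b (f a) (f b))
      \<le> (\<Sum>b<n. \<Sum>a<b. \<Sum>i\<le>n. \<Sum>i'\<le>n. p a i * p b i' * c a b i i')"
    using exists_rounding[of "{..n}" p n "\<lambda>_ _. 0" c, OF _ p_nonneg p_sum] by auto
  \<comment> \<open>The rectangles \<open>R q\<close>, for \<open>q\<close> in \<open>Q\<close>, are disjoint and the two pulled back graphons differ by
    exactly \<open>\<rho>\<close> on each of them.\<close>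
  define R where "R = (\<lambda>(b, a, i, i'). E i a \<times> E i' b)"
  define K where "K = (SIGMA b:{..<n}. SIGMA a:{..<b}. {..n} \<times> {..n})"
  define Q where "Q = {(b, a, i, i') \<in> K. ({i, i'} \<in> G) \<noteq> ({a, b} \<in> G')}"
  have K: "finite K" unfolding K_def by (intro finite_SigmaI) auto
  moreover have QK: "Q \<subseteq> K" unfolding Q_def by blast
  ultimately have Q: "finite Q" using finite_subset by blast
  have square: "unit_itv \<times> unit_itv \<in> sets lebesgue"
    using lmeasurable_square by (rule fmeasurableD)
  have R_sub: "R q \<subseteq> unit_itv \<times> unit_itv" for q
    by (cases q) (auto simp: R_def E_def)
  have R_lebesgue: "R q \<in> sets lebesgue" for q
    using lebesgue_Times(1)[OF E_meas E_meas] by (cases q) (simp add: R_def)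
  have R_sets: "R q \<in> sets ?M" for q
    using square R_sub R_lebesgue by (simp add: sets_restrict_space_iff)
  have R_measure: "measure ?M (R (b, a, i, i')) = measure lebesgue (E i a) * measure lebesgue (E i' b)"
    for a b i i'
  proof -
    have "measure ?M (R (b, a, i, i')) = measure lebesgue (R (b, a, i, i'))"
      using square R_sub by (intro measure_restrict_space) auto
    then show ?thesis by (simp add: R_def measure_lebesgue_Times E_meas)
  qed
  have "(\<Sum>b<n. \<Sum>a<b. \<Sum>i\<le>n. \<Sum>i'\<le>n. p a i * p b i' * c a b i i')
      = (\<Sum>(b, a, i, i')\<in>K. p a i * p b i' * c a b i i')"
    unfolding K_def by (simp add: sum.Sigma sum.cartesian_product)
  also have "\<dots> = (\<Sum>(b, a, i, i')\<in>Q. p a i * p b i' * c a b i i')"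
    using K QK by (intro sum.mono_neutral_right) (auto simp: Q_def c_def)
  also have "\<dots> = (\<Sum>q\<in>Q. (real n)\<^sup>2 * measure ?M (R q))"
    by (intro sum.cong refl) (auto simp: Q_def c_def p_def R_measure power2_eq_square)
  also have "\<dots> = (real n)\<^sup>2 * measure ?M (\<Union>q\<in>Q. R q)"
    using Q R_sets by (subst finite_measure_finite_Union)
      (auto simp: sum_distrib_left disjoint_family_on_def R_def E_def)
  finally have le2: "(\<Sum>b<n. \<Sum>a<b. c a b (f a) (f b)) \<le> (real n)\<^sup>2 * measure ?M (\<Union>q\<in>Q. R q)"
    using le by simp
  let ?W = "\<lambda>(x, y). pullback (graph_graphon \<rho> n G) \<phi> x y"
    and ?W' = "\<lambda>(x, y). pullback (graph_graphon \<rho> n G') \<psi> x y"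
  have V: "(\<Union>q\<in>Q. R q) \<in> sets ?M" using Q R_sets by auto
  have "\<rho>\<^sup>2 * measure ?M (\<Union>q\<in>Q. R q) = (\<integral>z. \<rho>\<^sup>2 * indicat_real (\<Union>q\<in>Q. R q) z \<partial>?M)"
    using V Int_absorb2[of "\<Union>q\<in>Q. R q" "unit_itv \<times> unit_itv", OF UN_least[OF R_sub]] by simp
  also have "\<dots> \<le> (\<integral>z. (?W z - ?W' z)\<^sup>2 \<partial>?M)"
  proof (rule integral_mono)
    show "integrable ?M (\<lambda>z. \<rho>\<^sup>2 * indicat_real (\<Union>q\<in>Q. R q) z :: real)"
      using V by (intro integrable_mult_right integrable_real_indicator) (auto simp: emeasure_eq_measure)
    show "integrable ?M (\<lambda>z. (?W z - ?W' z)\<^sup>2)"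
      using mp \<rho> by (intro integrable_sqdiff measurable_pullback graph_graphon_in_graphons_upto)
        (auto simp: pullback_def graph_graphon_def)
    fix z
    show "\<rho>\<^sup>2 * indicat_real (\<Union>q\<in>Q. R q) z \<le> (?W z - ?W' z)\<^sup>2"
      by (cases z) (auto simp: indicator_def R_def Q_def E_def pullback_def graph_graphon_def insert_commute)
  qed
  finally have int: "\<rho>\<^sup>2 * measure ?M (\<Union>q\<in>Q. R q) \<le> (\<integral>z. (?W z - ?W' z)\<^sup>2 \<partial>?M)" .
  have "real (card {e \<in> complete_graph n. (f ` e \<in> G) \<noteq> (e \<in> G')})
      \<le> (real n)\<^sup>2 * measure ?M (\<Union>q\<in>Q. R q)"
    using card_edges_le_sum[of n "\<lambda>e. (f ` e \<in> G) \<noteq> (e \<in> G')"] le2 by (simp add: c_def)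
  then have "\<rho>\<^sup>2 * real (card {e \<in> complete_graph n. (f ` e \<in> G) \<noteq> (e \<in> G')})
      \<le> \<rho>\<^sup>2 * ((real n)\<^sup>2 * measure ?M (\<Union>q\<in>Q. R q))"
    by (rule mult_left_mono) simp
  also have "\<dots> = (real n)\<^sup>2 * (\<rho>\<^sup>2 * measure ?M (\<Union>q\<in>Q. R q))" by simp
  also have "\<dots> \<le> (real n)\<^sup>2 * (\<integral>z. (?W z - ?W' z)\<^sup>2 \<partial>?M)"
    using int by (rule mult_left_mono) simp
  finally show ?thesis using f by (auto simp: case_prod_unfold intro!: bexI[of _ f])
qed

section \<open>An exponentially large packing\<close>

theorem proposition5:
  "\<exists>C>0. \<exists>c>0. \<forall>k::nat. \<forall>\<rho>::real. k \<ge> 1 \<longrightarrow> 0 < \<rho> \<longrightarrow> \<rho> \<le> 1 \<longrightarrow>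
     ereal_of_enat (packing_number (graphons_upto \<rho>) delta2 (C * \<rho>) (graphons_upto \<rho>))
       \<ge> ereal (2 powr (c * (real k)\<^sup>2))"
proof (intro exI conjI allI impI)
  show "(0::real) < 1 / 16" "(0::real) < 1" by simp_all
  fix k :: nat and \<rho> :: real
  assume k: "k \<ge> 1" and \<rho>: "0 < \<rho>" "\<rho> \<le> 1"
  \<comment> \<open>The factor 64 makes \<open>n\<close> large enough for the number of vertex maps to be negligible
    even if \<open>k\<close> is 1.\<close>
  define n where "n = 64 * k"
  define dist2 where "dist2 G \<phi> G' \<psi> =
    (\<integral>(x, y). (pullback (graph_graphon \<rho> n G) \<phi> x y - pullback (graph_graphon \<rho> n G') \<psi> x y)\<^sup>2
      \<partial>lebesgue_on (unit_itv \<times> unit_itv))" for G \<phi> G' \<psi>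
  define near where "near G G' \<longleftrightarrow> (\<exists>\<phi>\<in>measure_preserving_maps. \<exists>\<psi>\<in>measure_preserving_maps.
    dist2 G \<phi> G' \<psi> < 4 * (1 / 16 * \<rho>)\<^sup>2)" for G G'
  define b where "b = (64 * real k + 1) ^ (64 * k) * 4 ^ (64 * k\<^sup>2) * (5 / 4) ^ ((64 * k) choose 2)"
  have n: "n > 0" using k by (simp add: n_def)
  have finK: "finite (complete_graph n)" by (simp add: complete_graph_def)
  have "dist2 G \<phi> G' \<psi> = dist2 G' \<psi> G \<phi>" for G \<phi> G' \<psi>
    unfolding dist2_def by (simp add: power2_commute)
  then have near_sym: "near G' G" if "near G G'" for G G'
    using that unfolding near_def by metis
  have refl: "near G G" for G
  proof -
    have "dist2 G (\<lambda>x. x) G (\<lambda>x. x) = 0" by (simp add: dist2_def case_prod_unfold)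
    then show ?thesis using id_measure_preserving \<rho> unfolding near_def
      by (intro bexI[of _ "\<lambda>x. x"]) auto
  qed
  have few: "card {G' \<in> Pow (complete_graph n). near G G'} \<le> b" for G
  proof -
    \<comment> \<open>Each near graph lies in a Hamming ball around one of at most \<open>(n + 1) ^ n\<close> preimages of \<open>G\<close>.\<close>
    define pre where "pre f = {e \<in> complete_graph n. f ` e \<in> G}" for f :: "nat \<Rightarrow> nat"
    define ball where "ball T = {S. S \<subseteq> complete_graph n \<and>
      card {e \<in> complete_graph n. (e \<in> T) \<noteq> (e \<in> S)} \<le> 64 * k\<^sup>2}" for T
    let ?maps = "{..<n} \<rightarrow>\<^sub>E {..n}"
    have "\<exists>f\<in>?maps. G' \<in> ball (pre f)" if G': "G' \<subseteq> complete_graph n" "near G G'" for G'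
    proof -
      obtain \<phi> \<psi> where mp: "\<phi> \<in> measure_preserving_maps" "\<psi> \<in> measure_preserving_maps"
        and lt: "dist2 G \<phi> G' \<psi> < 4 * (1 / 16 * \<rho>)\<^sup>2"
        using G'(2) unfolding near_def by blast
      obtain f where f: "f \<in> ?maps"
        and le: "\<rho>\<^sup>2 * real (card {e \<in> complete_graph n. (f ` e \<in> G) \<noteq> (e \<in> G')})
          \<le> (real n)\<^sup>2 * dist2 G \<phi> G' \<psi>"
        using exists_vertex_map_close[OF n _ _ mp, of \<rho> G G'] \<rho> unfolding dist2_def by auto
      have "\<rho>\<^sup>2 * real (card {e \<in> complete_graph n. (f ` e \<in> G) \<noteq> (e \<in> G')})
          \<le> (real n)\<^sup>2 * (4 * (1 / 16 * \<rho>)\<^sup>2)"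
        using le lt by (meson less_imp_le mult_left_mono order_trans zero_le_power2)
      also have "\<dots> = \<rho>\<^sup>2 * real (64 * k\<^sup>2)"
        by (simp add: n_def power2_eq_square)
      finally have "card {e \<in> complete_graph n. (f ` e \<in> G) \<noteq> (e \<in> G')} \<le> 64 * k\<^sup>2"
        using \<rho> by (simp only: mult_le_cancel_left_pos zero_less_power of_nat_le_iff)
      moreover have "{e \<in> complete_graph n. (e \<in> pre f) \<noteq> (e \<in> G')}
          = {e \<in> complete_graph n. (f ` e \<in> G) \<noteq> (e \<in> G')}"
        by (auto simp: pre_def)
      ultimately have "G' \<in> ball (pre f)" using G'(1) unfolding ball_def by simp
      then show ?thesis using f by blast
    qed
    then have "{G' \<in> Pow (complete_graph n). near G G'} \<subseteq> (\<Union>f\<in>?maps. ball (pre f))" by blast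
    moreover have fin: "finite ?maps" by (intro finite_PiE) auto
    moreover have "finite (ball T)" for T
      using finK by (intro finite_subset[of "ball T" "Pow (complete_graph n)"]) (auto simp: ball_def)
    ultimately have "card {G' \<in> Pow (complete_graph n). near G G'} \<le> card (\<Union>f\<in>?maps. ball (pre f))"
      by (intro card_mono) auto
    also have "\<dots> \<le> (\<Sum>f\<in>?maps. card (ball (pre f)))" using fin by (rule card_UN_le)
    finally have "real (card {G' \<in> Pow (complete_graph n). near G G'}) \<le> (\<Sum>f\<in>?maps. real (card (ball (pre f))))"
      by (simp flip: of_nat_sum)
    also have "\<dots> \<le> card ?maps * (4 ^ (64 * k\<^sup>2) * (5 / 4) ^ (n choose 2))"
    proof (rule sum_bounded_above)
      fix f
      have "pre f \<subseteq> complete_graph n" by (auto simp: pre_def)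
      from card_hamming_ball_le[OF finK this, of "64 * k\<^sup>2"]
      show "real (card (ball (pre f))) \<le> 4 ^ (64 * k\<^sup>2) * (5 / 4) ^ (n choose 2)"
        unfolding ball_def card_complete_graph .
    qed
    also have "\<dots> = b"
      by (simp add: card_funcsetE b_def n_def add.commute)
    finally show ?thesis .
  qed
  obtain F where F: "F \<subseteq> Pow (complete_graph n)"
    and sep: "\<forall>G\<in>F. \<forall>G'\<in>F. G \<noteq> G' \<longrightarrow> \<not> near G G'"
    and card: "card (Pow (complete_graph n)) \<le> card F * b"
    using exists_separated_subfamily[of "Pow (complete_graph n)" near b, OF _ near_sym refl few]
      finK by auto
  have finF: "finite F" using F finK by (meson finite_Pow_iff finite_subset)
  have b: "b > 0" unfolding b_def by (intro mult_pos_pos zero_less_power) auto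
  have "2 ^ k\<^sup>2 * b \<le> 2 ^ (n choose 2)"
    using counting_estimate[OF k] by (simp add: b_def n_def)
  also have "\<dots> \<le> card F * b"
    using card finK by (simp add: card_Pow card_complete_graph)
  finally have "2 ^ k\<^sup>2 \<le> real (card F)" using b by simp
  then have large: "2 powr (1 * (real k)\<^sup>2) \<le> real (card F)"
    by (simp add: powr_realpow flip: of_nat_power)
  have "enat (card F) \<le> packing_number (graphons_upto \<rho>) delta2 (1 / 16 * \<rho>) (graphons_upto \<rho>)"
  proof (rule packing_number_ge_card[OF finF])
    fix G G' \<phi> \<psi>
    assume "G \<in> F" "G' \<in> F" "G \<noteq> G'" "\<phi> \<in> measure_preserving_maps" "\<psi> \<in> measure_preserving_maps"
    then have "4 * (1 / 16 * \<rho>)\<^sup>2 \<le> dist2 G \<phi> G' \<psi>"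
      using sep unfolding near_def by (meson not_less)
    then show "4 * (1 / 16 * \<rho>)\<^sup>2 \<le> (\<integral>(x, y). (pullback (graph_graphon \<rho> n G) \<phi> x y
        - pullback (graph_graphon \<rho> n G') \<psi> x y)\<^sup>2 \<partial>lebesgue_on (unit_itv \<times> unit_itv))"
      unfolding dist2_def .
  qed (use \<rho> graph_graphon_in_graphons_upto in auto)
  then have "ereal_of_enat (enat (card F)) \<le>
      ereal_of_enat (packing_number (graphons_upto \<rho>) delta2 (1 / 16 * \<rho>) (graphons_upto \<rho>))"
    by (simp only: ereal_of_enat_le_iff)
  moreover have "ereal (2 powr (1 * (real k)\<^sup>2)) \<le> ereal_of_enat (enat (card F))"
    using large by simp
  ultimately show "ereal (2 powr (1 * (real k)\<^sup>2)) \<le>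
      ereal_of_enat (packing_number (graphons_upto \<rho>) delta2 (1 / 16 * \<rho>) (graphons_upto \<rho>))"
    by (rule order_trans[rotated])
qed

end
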